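(* Let $k\ge 1$, $G=K_{3k}$ and $H=K_3$. Then $\gamma_{MR}(G\circ H)=-k$, where $G\circ H$ is the corona of $G$ and $H$.
   Context: All graphs are finite and simple. For a vertex $v$ of $G=(V,E)$, $N[v]=\{v\}\cup\{u: uv\in E\}$ is the closed neighborhood, and for $f:V\to\mathbb{R}$ and $S\subseteq V$, $f(S)=\sum_{x\in S}f(x)$. A majority Roman dominating function (MRDF) on $G$ is a function $f:V\to\{-1,1,2\}$ such that (i) $f(N[v])\ge 1$ for at least half of the vertices $v\in V$, and (ii) every vertex $u$ with $f(u)=-1$ is adjacent to at least one vertex $w$ with $f(w)=2$. The weight of $f$ is $f(V)$, and the majority Roman domination number $\gamma_{MR}(G)$ is the minimum weight of an MRDF on $G$. The corona $G_1\circ G_2$ is the graph formed from one copy of $G_1$ and $|V(G_1)|$ copies of $G_2$ by making the $i$-th vertex of $G_1$ adjacent to every vertex of the $i$-th copy of $G_2$. *)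

theory Defs
  imports "Graph_Theory.Graph_Theory"
begin

text \<open>
  A finite simple graph is an instance of the locale \<^locale>\<open>pair_graph\<close>: a finite, loop-free
  digraph whose arc relation is symmetric, each edge being represented by its two orientations.
\<close>

definition closed_neighborhood :: "'a pair_pre_digraph \<Rightarrow> 'a \<Rightarrow> 'a set" where
  "closed_neighborhood G v = {v} \<union> {u. (u, v) \<in> parcs G}"

text \<open>
  Only the values of \<open>f\<close> on the vertices matter; \<open>f\<close> is arbitrary elsewhere.
\<close>

definition MRDF :: "'a pair_pre_digraph \<Rightarrow> ('a \<Rightarrow> int) \<Rightarrow> bool" where
  "MRDF G f \<longleftrightarrow>
     f ` pverts G \<subseteq> {-1, 1, 2} \<and>
     2 * card {v \<in> pverts G. sum f (closed_neighborhood G v) \<ge> 1} \<ge> card (pverts G) \<and>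
     (\<forall>u \<in> pverts G. f u = -1 \<longrightarrow> (\<exists>w \<in> pverts G. (u, w) \<in> parcs G \<and> f w = 2))"

definition majority_roman_domination_number :: "'a pair_pre_digraph \<Rightarrow> int" where
  "majority_roman_domination_number G = Min {sum f (pverts G) | f. MRDF G f}"

text \<open>
  In the corona, \<open>Inl v\<close> is the vertex \<open>v\<close> of \<open>G\<close> and \<open>Inr (v, x)\<close> is the vertex \<open>x\<close> of
  the copy of \<open>H\<close> attached to \<open>v\<close>.
\<close>

definition corona ::
  "'a pair_pre_digraph \<Rightarrow> 'b pair_pre_digraph \<Rightarrow> ('a + 'a \<times> 'b) pair_pre_digraph" where
  "corona G H =
     \<lparr> pverts = Inl ` pverts G \<union> Inr ` (pverts G \<times> pverts H),
       parcs =
         {(Inl u, Inl v) | u v. (u, v) \<in> parcs G} \<union>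
         {(Inr (v, x), Inr (v, y)) | v x y. v \<in> pverts G \<and> (x, y) \<in> parcs H} \<union>
         {(Inl v, Inr (v, x)) | v x. v \<in> pverts G \<and> x \<in> pverts H} \<union>
         {(Inr (v, x), Inl v) | v x. v \<in> pverts G \<and> x \<in> pverts H} \<rparr>"

lemma pair_graph_corona:
  assumes "pair_graph G" "pair_graph H"
  shows "pair_graph (corona G H)"
proof -
  interpret G: pair_graph G by fact
  interpret H: pair_graph H by fact
  have V: "finite (pverts (corona G H))"
    by (simp add: corona_def G.pair_finite_verts H.pair_finite_verts)
  have sub: "parcs (corona G H) \<subseteq> pverts (corona G H) \<times> pverts (corona G H)"
    by (auto simp: corona_def dest: G.in_arcsD1 G.in_arcsD2 H.in_arcsD1 H.in_arcsD2)
  have symG: "(v, u) \<in> parcs G" if "(u, v) \<in> parcs G" for u v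
    using G.pair_sym_arcs that by (auto simp: symmetric_def elim: symE)
  have symH: "(v, u) \<in> parcs H" if "(u, v) \<in> parcs H" for u v
    using H.pair_sym_arcs that by (auto simp: symmetric_def elim: symE)
  have symC: "sym (parcs (corona G H))"
    by (rule symI) (auto simp: corona_def intro: symG symH)
  have loop: "fst e \<noteq> snd e" if "e \<in> parcs (corona G H)" for e
    using that by (auto simp: corona_def dest: G.pair_no_loops H.pair_no_loops)
  interpret C: pair_wf_digraph "corona G H"
    using sub by unfold_locales auto
  show ?thesis
    using V finite_subset[OF sub] symC loop
    by unfold_locales (auto simp: symmetric_def)
qed

text \<open>The minimum defining the majority Roman domination number exists.\<close>

lemma finite_MRDF_weights:
  assumes "finite (pverts G)"
  shows "finite {sum f (pverts G) | f. MRDF G f}"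
proof (rule finite_subset)
  show "{sum f (pverts G) | f. MRDF G f} \<subseteq>
      (\<lambda>f. sum f (pverts G)) ` (pverts G \<rightarrow>\<^sub>E {-1, 1, 2})"
  proof clarify
    fix f assume "MRDF G f"
    then have "restrict f (pverts G) \<in> pverts G \<rightarrow>\<^sub>E {-1, 1, 2}"
      by (auto simp: MRDF_def)
    moreover have "sum f (pverts G) = sum (restrict f (pverts G)) (pverts G)"
      by simp
    ultimately show "sum f (pverts G) \<in>
        (\<lambda>f. sum f (pverts G)) ` (pverts G \<rightarrow>\<^sub>E {-1, 1, 2})"
      by blast
  qed
  show "finite ((\<lambda>f. sum f (pverts G)) ` (pverts G \<rightarrow>\<^sub>E {-1, 1, 2 :: int}))"
    using assms by (intro finite_imageI finite_PiE) auto
qed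

lemma MRDF_const_one:
  assumes "pair_graph G"
  shows "MRDF G (\<lambda>_. 1)"
proof -
  interpret pair_graph G by fact
  have "finite (closed_neighborhood G v)" for v
    by (rule finite_subset[of _ "insert v (pverts G)"])
      (auto simp: closed_neighborhood_def pair_finite_verts dest: in_arcsD1)
  then have "card (closed_neighborhood G v) \<ge> 1" for v
    by (metis One_nat_def Suc_leI UnI1 card_gt_0_iff closed_neighborhood_def empty_iff singletonI)
  then have "{v \<in> pverts G. (\<Sum>_\<in>closed_neighborhood G v. 1 :: int) \<ge> 1} = pverts G"
    by (auto simp: nat_le_iff)
  then show ?thesis
    unfolding MRDF_def by auto
qed

lemma majority_roman_domination_number_attained:
  assumes "pair_graph G"
  shows "\<exists>f. MRDF G f \<and> sum f (pverts G) = majority_roman_domination_number G"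
proof -
  interpret pair_graph G by fact
  have "majority_roman_domination_number G \<in> {sum f (pverts G) | f. MRDF G f}"
    unfolding majority_roman_domination_number_def
    using MRDF_const_one[OF assms] by (intro Min_in finite_MRDF_weights pair_finite_verts) auto
  then show ?thesis by auto
qed

lemma majority_roman_domination_number_le:
  assumes "pair_graph G" "MRDF G f"
  shows "majority_roman_domination_number G \<le> sum f (pverts G)"
proof -
  interpret pair_graph G by fact
  show ?thesis
    unfolding majority_roman_domination_number_def
    using assms(2) by (intro Min_le finite_MRDF_weights pair_finite_verts) auto
qed

end

theory Submission
  imports Defs
begin

text \<open>
  Every copy of \<open>K\<^sub>3\<close> together with its vertex of \<open>G\<close> forms a block, whose weight is the
  closed-neighborhood sum at each of the three vertices of the copy. For an MRDF a block weighs
  at least \<open>-1\<close> and never \<open>0\<close>. If \<open>p\<close> of the \<open>3k\<close> blocks are positive, then at most \<open>3p + 3k\<close>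
  of the \<open>12k\<close> vertices have a positive closed-neighborhood sum, so \<open>p \<ge> k\<close> and the weight is at
  least \<open>p - (3k - p) \<ge> -k\<close>. Equality holds when \<open>G\<close> gets value \<open>2\<close> throughout, \<open>k\<close> of
  the copies get \<open>(1, -1, -1)\<close> and the other \<open>2k\<close> copies get \<open>(-1, -1, -1)\<close>.
\<close>

definition block_weight ::
  "'b pair_pre_digraph \<Rightarrow> ('a + 'a \<times> 'b \<Rightarrow> int) \<Rightarrow> 'a \<Rightarrow> int" where
  "block_weight H f v = f (Inl v) + (\<Sum>x\<in>pverts H. f (Inr (v, x)))"

lemma closed_neighborhood_complete:
  assumes "complete_digraph n (with_proj G)" "v \<in> pverts G"
  shows "closed_neighborhood G v = pverts G"
  using assms by (auto simp: complete_digraph_pair_def closed_neighborhood_def)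

lemma closed_neighborhood_corona_Inl:
  assumes "v \<in> pverts G"
  shows "closed_neighborhood (corona G H) (Inl v) =
    Inl ` closed_neighborhood G v \<union> (\<lambda>x. Inr (v, x)) ` pverts H"
  using assms by (auto simp: closed_neighborhood_def corona_def)

lemma closed_neighborhood_corona_Inr:
  assumes "v \<in> pverts G" "x \<in> pverts H"
  shows "closed_neighborhood (corona G H) (Inr (v, x)) =
    insert (Inl v) ((\<lambda>y. Inr (v, y)) ` closed_neighborhood H x)"
  using assms by (auto simp: closed_neighborhood_def corona_def)

text \<open>As \<open>G\<close> is complete, a vertex of \<open>G\<close> sees all of
  \<open>G\<close> but only its own copy of \<open>H\<close>. This gives the sums at the vertices of
  \<open>G\<close> in the extremal construction.\<close>

lemma sum_closed_neighborhood_corona_Inl: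
  assumes "complete_digraph n (with_proj G)" "finite (pverts H)" "v \<in> pverts G"
  shows "sum f (closed_neighborhood (corona G H) (Inl v)) =
    (\<Sum>u\<in>pverts G. f (Inl u)) + (\<Sum>x\<in>pverts H. f (Inr (v, x)))"
proof -
  have "finite (pverts G)"
    using assms(1) by (simp add: complete_digraph_pair_def)
  then show ?thesis
    using assms(2)
    by (simp add: closed_neighborhood_corona_Inl[OF assms(3)]
        closed_neighborhood_complete[OF assms(1,3)], subst sum.union_disjoint)
      (auto simp: sum.reindex inj_on_def)
qed

lemma sum_closed_neighborhood_corona_Inr:
  assumes "complete_digraph n (with_proj H)" "v \<in> pverts G" "x \<in> pverts H"
  shows "sum f (closed_neighborhood (corona G H) (Inr (v, x))) = block_weight H f v"
proof -
  have "finite (pverts H)"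
    using assms(1) by (simp add: complete_digraph_pair_def)
  then show ?thesis
    by (simp add: closed_neighborhood_corona_Inr[OF assms(2,3)] block_weight_def
        closed_neighborhood_complete[OF assms(1,3)], subst sum.insert)
      (auto simp: sum.reindex inj_on_def)
qed

lemma sum_corona:
  assumes "finite (pverts G)" "finite (pverts H)"
  shows "sum f (pverts (corona G H)) = (\<Sum>v\<in>pverts G. block_weight H f v)"
proof -
  have "sum f (pverts (corona G H)) =
      sum f (Inl ` pverts G) + sum f (Inr ` (pverts G \<times> pverts H))"
    unfolding corona_def pair_pre_digraph.simps
    using assms by (intro sum.union_disjoint) auto
  then show ?thesis
    by (simp add: sum.reindex block_weight_def sum.distrib sum.cartesian_product)
qed

lemma card_corona:
  assumes "finite (pverts G)" "finite (pverts H)"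
  shows "card (pverts (corona G H)) = card (pverts G) * (card (pverts H) + 1)"
proof -
  show ?thesis
    unfolding corona_def pair_pre_digraph.simps
    using assms by (subst card_Un_disjoint) (auto simp: card_image card_cartesian_product)
qed

text \<open>If the copy has no value -1, the block weighs at least 3 - 1 = 2. Otherwise the block
  contains a 2, and the other three values sum to -3 or to at least -1, never to -2.\<close>

lemma block_weight_MRDF_cases:
  assumes "MRDF (corona G H) f" "card (pverts H) = 3" "v \<in> pverts G"
  shows "block_weight H f v = -1 \<or> block_weight H f v \<ge> 1"
proof -
  obtain a b c where H: "pverts H = {a, b, c}" and d: "a \<noteq> b" "a \<noteq> c" "b \<noteq> c"
    using assms(2) by (auto simp: card_3_iff)
  have range: "f u \<in> {-1, 1, 2}" if "u \<in> pverts (corona G H)" for u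
    using assms(1) that by (auto simp: MRDF_def)
  have val: "f (Inl v) \<in> {-1, 1, 2}" "f (Inr (v, x)) \<in> {-1, 1, 2}" if "x \<in> pverts H" for x
    using that assms(3) range[of "Inl v"] range[of "Inr (v, x)"] by (auto simp: corona_def)
  \<comment> \<open>All neighbors of a copy vertex lie in its own block. This is claimed for copy
    vertices only: \<open>Inl v\<close> may have its neighbor of value 2 in another block.\<close>
  have dom: "f (Inl v) = 2 \<or> (\<exists>y\<in>pverts H. f (Inr (v, y)) = 2)"
    if x: "x \<in> pverts H" "f (Inr (v, x)) = -1" for x
  proof -
    have "Inr (v, x) \<in> pverts (corona G H)"
      using x(1) assms(3) by (simp add: corona_def)
    then obtain w where "w \<in> pverts (corona G H)" "(Inr (v, x), w) \<in> parcs (corona G H)" "f w = 2"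
      using assms(1) x(2) by (auto simp: MRDF_def)
    then show ?thesis
      by (auto simp: corona_def)
  qed
  show ?thesis
    using val[of a] val[of b] val[of c] dom[of a] dom[of b] dom[of c] d
    by (auto simp: H block_weight_def)
qed

lemma positive_corona_vertices:
  fixes G :: "'a pair_pre_digraph" and H :: "'b pair_pre_digraph"
  assumes "complete_digraph n (with_proj H)"
  shows "{u \<in> pverts (corona G H). sum f (closed_neighborhood (corona G H) u) \<ge> (1::int)} =
    Inl ` {v \<in> pverts G. sum f (closed_neighborhood (corona G H) (Inl v)) \<ge> 1} \<union>
    Inr ` ({v \<in> pverts G. block_weight H f v \<ge> 1} \<times> pverts H)"
proof -
  have V: "pverts (corona G H) = Inl ` pverts G \<union> Inr ` (pverts G \<times> pverts H)"
    by (simp add: corona_def)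
  show ?thesis
    unfolding V by (auto simp: sum_closed_neighborhood_corona_Inr[OF assms])
qed

text \<open>The vertices of one copy share the same sum, the weight of their block, so each positive
  block contributes all \<open>n\<close> of them.\<close>

lemma card_positive_corona_vertices:
  fixes G :: "'a pair_pre_digraph" and H :: "'b pair_pre_digraph"
  assumes "complete_digraph n (with_proj H)" "finite (pverts G)"
  shows "card {u \<in> pverts (corona G H). sum f (closed_neighborhood (corona G H) u) \<ge> (1::int)} =
    card {v \<in> pverts G. sum f (closed_neighborhood (corona G H) (Inl v)) \<ge> 1} +
    card {v \<in> pverts G. block_weight H f v \<ge> 1} * n"
proof -
  have "finite (pverts H)" "card (pverts H) = n"
    using assms(1) by (simp_all add: complete_digraph_pair_def)
  then show ?thesis
    unfolding positive_corona_vertices[OF assms(1)]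
    using assms(2)
    by (subst card_Un_disjoint) (auto simp: card_image card_cartesian_product)
qed

lemma MRDF_corona_triangle_ge:
  assumes G: "complete_digraph (3 * k) (with_proj G)" and H: "complete_digraph 3 (with_proj H)"
    and f: "MRDF (corona G H) f"
  shows "- int k \<le> sum f (pverts (corona G H))"
proof -
  let ?w = "block_weight H f"
  define P where "P = {v \<in> pverts G. ?w v \<ge> 1}"
  have fin: "finite (pverts G)" "finite (pverts H)"
    and card: "card (pverts G) = 3 * k" "card (pverts H) = 3"
    using G H by (simp_all add: complete_digraph_pair_def)
  have P: "P \<subseteq> pverts G" "finite P"
    using fin by (auto simp: P_def)
  \<comment> \<open>The trivial bound suffices here, since in the extremal function all vertices of
    \<open>G\<close> have a positive sum.\<close>
  have "card {v \<in> pverts G. sum f (closed_neighborhood (corona G H) (Inl v)) \<ge> 1} \<le> 3 * k"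
    (is "?c \<le> _")
    using fin card by (metis (no_types, lifting) card_mono mem_Collect_eq subsetI)
  moreover have "2 * card {u \<in> pverts (corona G H).
      sum f (closed_neighborhood (corona G H) u) \<ge> 1} \<ge> 12 * k"
    (is "2 * ?q \<ge> _")
    using f by (simp add: MRDF_def card_corona[OF fin] card)
  moreover have "?q = ?c + card P * 3"
    unfolding P_def by (rule card_positive_corona_vertices[OF H fin(1)])
  \<comment> \<open>Half of the 12k vertices is 6k, and 6k \<le> ?c + 3 * card P \<le> 3k + 3 * card
    P.\<close>
  ultimately have kP: "k \<le> card P"
    by linarith
  \<comment> \<open>On \<open>P\<close> the bound is the definition of \<open>P\<close>; elsewhere
    it comes from the possible block weights.\<close>
  have "(\<Sum>v\<in>pverts G. ?w v) \<ge> (\<Sum>v\<in>pverts G. if v \<in> P then 1 else -1)"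
    using block_weight_MRDF_cases[OF f card(2)] by (intro sum_mono) (fastforce simp: P_def)
  also have "(\<Sum>v\<in>pverts G. if v \<in> P then 1 else -1) = int (card P) - int (card (pverts G - P))"
    using fin P by (simp add: sum.If_cases Int_absorb1 Diff_eq)
  also have "card (pverts G - P) = 3 * k - card P"
    using P by (simp add: card_Diff_subset card)
  \<comment> \<open>\<open>card_mono\<close> gives card P \<le> 3k, so the natural-number
    subtraction is not truncated and the bound is 2 * card P - 3k.\<close>
  finally show ?thesis
    using kP card_mono[OF fin(1) P(1)] card by (simp add: sum_corona[OF fin])
qed

lemma MRDF_corona_triangle_attained:
  fixes G :: "'a pair_pre_digraph" and H :: "'b pair_pre_digraph"
  assumes k: "k \<ge> 1"
    and G: "complete_digraph (3 * k) (with_proj G)" and H: "complete_digraph 3 (with_proj H)"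
  shows "\<exists>f. MRDF (corona G H) f \<and> sum f (pverts (corona G H)) = - int k"
proof -
  have fin: "finite (pverts G)" "finite (pverts H)"
    and card: "card (pverts G) = 3 * k" "card (pverts H) = 3"
    using G H by (simp_all add: complete_digraph_pair_def)
  obtain P where P: "P \<subseteq> pverts G" "card P = k" "finite P"
    using obtain_subset_with_card_n[of k "pverts G"] card by auto
  obtain a b c where abc: "pverts H = {a, b, c}" "a \<noteq> b" "a \<noteq> c" "b \<noteq> c"
    using card(2) by (auto simp: card_3_iff)
  define f :: "'a + 'a \<times> 'b \<Rightarrow> int" where
    "f = case_sum (\<lambda>v. 2) (\<lambda>(v, x). if v \<in> P \<and> x = a then 1 else -1)"
  \<comment> \<open>2 + 1 - 1 - 1 = 1 on \<open>P\<close> and 2 - 3 = -1 off it.\<close>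
  have w: "block_weight H f v = (if v \<in> P then 1 else -1)" for v
    using abc by (simp add: block_weight_def f_def)
  \<comment> \<open>The sum is 6k - 1 or 6k - 3, which is positive because k \<ge> 1.\<close>
  have "sum f (closed_neighborhood (corona G H) (Inl v)) \<ge> 1" if "v \<in> pverts G" for v
    using k abc card
    by (simp add: sum_closed_neighborhood_corona_Inl[OF G fin(2) that] f_def)
  then have "{v \<in> pverts G. sum f (closed_neighborhood (corona G H) (Inl v)) \<ge> 1} = pverts G"
    by auto
  moreover have "{v \<in> pverts G. block_weight H f v \<ge> 1} = P"
    using P(1) by (auto simp: w)
  \<comment> \<open>All 3k vertices of \<open>G\<close> and three for each of the k blocks in
    \<open>P\<close>: exactly half of the 12k vertices.\<close>
  ultimately have maj: "card {u \<in> pverts (corona G H).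
      sum f (closed_neighborhood (corona G H) u) \<ge> 1} = 6 * k"
    by (simp add: card_positive_corona_vertices[OF H fin(1)] card P(2))
  have "f ` pverts (corona G H) \<subseteq> {-1, 1, 2}"
    by (auto simp: f_def split: sum.splits)
  \<comment> \<open>The value -1 occurs only in copies, where the attached vertex of
    \<open>G\<close> has value 2.\<close>
  moreover have "\<exists>w\<in>pverts (corona G H). (u, w) \<in> parcs (corona G H) \<and> f w = 2"
    if "u \<in> pverts (corona G H)" "f u = -1" for u
    using that by (auto simp: f_def corona_def)
  ultimately have "MRDF (corona G H) f"
    using maj by (simp add: MRDF_def card_corona[OF fin] card)
  moreover have "sum f (pverts (corona G H)) = - int k"
  proof -
    have "sum f (pverts (corona G H)) = int (card P) - int (card (pverts G - P))"
      using fin P by (simp add: sum_corona[OF fin] w sum.If_cases Int_absorb1 Diff_eq)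
    then show ?thesis
      using P by (simp add: card_Diff_subset card)
  qed
  ultimately show ?thesis
    by blast
qed

theorem theorem18:
  fixes k :: nat and G :: "'a pair_pre_digraph" and H :: "'b pair_pre_digraph"
  assumes "k \<ge> 1"
    and "complete_digraph (3 * k) (with_proj G)"
    and "complete_digraph 3 (with_proj H)"
  shows "majority_roman_domination_number (corona G H) = - int k"
proof (rule antisym)
  have C: "pair_graph (corona G H)"
    using assms(2,3) by (intro pair_graph_corona pair_graphI_complete)
  show "majority_roman_domination_number (corona G H) \<le> - int k"
    using MRDF_corona_triangle_attained[OF assms] majority_roman_domination_number_le[OF C] by metis
  show "- int k \<le> majority_roman_domination_number (corona G H)"
    using MRDF_corona_triangle_ge[OF assms(2,3)] majority_roman_domination_number_attained[OF C]
    by metis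
qed

end
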